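(* Let $X$ be a set equipped with two ternary relations $R$ and $S$ and a subset $E\subseteq X$. Let $(Q,\le,\bullet,\diamond)$ be a complete lattice with two binary operations $\bullet,\diamond$ each preserving arbitrary sups in both arguments, and suppose $1\in Q$ is a two-sided unit for both $\bullet$ and $\diamond$. On the function space $Q^X$ (ordered pointwise) consider the convolutions $\ast$ and $\circledast$ and the function $\mathit{id}_E$ defined below. (1) If $(X,R,S,E)$ is a relational interchange monoid and $(Q,\le,\bullet,\diamond,1)$ is an interchange quantale, then $(Q^X,\le,\ast,\circledast,\mathit{id}_E)$ is an interchange quantale. (2) If $(Q^X,\le,\ast,\circledast,\mathit{id}_E)$ is an interchange quantale and $1\neq 0$ in $Q$ (where $0$ is the least element of $Q$), then $(X,R,S,E)$ is a relational interchange monoid. (3) If $(Q^X,\le,\ast,\circledast,\mathit{id}_E)$ is an interchange quantale and $E\neq\emptyset$, then $(Q,\le,\bullet,\diamond,1)$ is an interchange quantale.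
   Context: A ternary relation $R$ on $X$ is a predicate on $X\times X\times X$; write $R^x_{yz}$ for "$R$ holds of $(x,y,z)$". $R$ is relationally associative if for all $x,u,v,w\in X$: $(\exists y.\ R^y_{uv}\wedge R^x_{yw})\Leftrightarrow(\exists y.\ R^x_{uy}\wedge R^y_{vw})$. A subset $E\subseteq X$ is a set of relational units for $R$ if for all $x,y\in X$: there is $e\in E$ with $R^x_{ex}$; $R^x_{ey}$ with $e\in E$ implies $x=y$; there is $e\in E$ with $R^x_{xe}$; $R^x_{ye}$ with $e\in E$ implies $x=y$. A relational interchange monoid $(X,R,S,E)$ consists of two relationally associative ternary relations $R,S$ on $X$, both having $E$ as a set of relational units, satisfying the relational interchange law: for all $t,u,v,w,x$, $(\exists y,z.\ S^y_{tu}\wedge R^x_{yz}\wedge S^z_{vw})\Rightarrow(\exists y,z.\ R^y_{tv}\wedge S^x_{yz}\wedge R^z_{uw})$. An interchange quantale $(Q,\le,\bullet,\diamond,1)$ is a complete lattice with two associative binary operations each preserving arbitrary sups (including the empty sup) in both arguments, with $1$ a two-sided unit of both, satisfying $(a\diamond b)\bullet(c\diamond d)\le(a\bullet c)\diamond(b\bullet d)$ for all $a,b,c,d$. Convolutions on functions $f,g:X\to Q$: $(f\ast g)(x)=\bigvee\{f(y)\bullet g(z)\mid R^x_{yz}\}$ and $(f\circledast g)(x)=\bigvee\{f(y)\diamond g(z)\mid S^x_{yz}\}$; $\mathit{id}_E(x)=1$ if $x\in E$ and $0$ otherwise. *)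

theory Defs
  imports "HOL-Algebra.Complete_Lattice" "HOL-Library.FuncSet"
begin

text \<open>
  For a ternary relation \<open>R\<close>, the term \<open>R x y z\<close> stands for \<open>R\<^sup>x\<^sub>y\<^sub>z\<close>: the upper index is the first
  argument. All quantifiers are relativised to the carrier \<open>X\<close>, so the values of \<open>R\<close> outside
  \<open>X \<times> X \<times> X\<close> are irrelevant.
\<close>

definition relationally_associative :: "'x set \<Rightarrow> ('x \<Rightarrow> 'x \<Rightarrow> 'x \<Rightarrow> bool) \<Rightarrow> bool" where
  "relationally_associative X R \<longleftrightarrow>
    (\<forall>x\<in>X. \<forall>u\<in>X. \<forall>v\<in>X. \<forall>w\<in>X.
      (\<exists>y\<in>X. R y u v \<and> R x y w) \<longleftrightarrow> (\<exists>y\<in>X. R x u y \<and> R y v w))"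

definition relational_units ::
    "'x set \<Rightarrow> ('x \<Rightarrow> 'x \<Rightarrow> 'x \<Rightarrow> bool) \<Rightarrow> 'x set \<Rightarrow> bool" where
  "relational_units X R E \<longleftrightarrow>
    E \<subseteq> X \<and>
    (\<forall>x\<in>X. \<forall>y\<in>X.
      (\<exists>e\<in>E. R x e x) \<and>
      (\<forall>e\<in>E. R x e y \<longrightarrow> x = y) \<and>
      (\<exists>e\<in>E. R x x e) \<and>
      (\<forall>e\<in>E. R x y e \<longrightarrow> x = y))"

definition relational_interchange ::
    "'x set \<Rightarrow> ('x \<Rightarrow> 'x \<Rightarrow> 'x \<Rightarrow> bool) \<Rightarrow> ('x \<Rightarrow> 'x \<Rightarrow> 'x \<Rightarrow> bool) \<Rightarrow> bool" where
  "relational_interchange X R S \<longleftrightarrow>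
    (\<forall>t\<in>X. \<forall>u\<in>X. \<forall>v\<in>X. \<forall>w\<in>X. \<forall>x\<in>X.
      (\<exists>y\<in>X. \<exists>z\<in>X. S y t u \<and> R x y z \<and> S z v w) \<longrightarrow>
      (\<exists>y\<in>X. \<exists>z\<in>X. R y t v \<and> S x y z \<and> R z u w))"

locale relational_interchange_monoid =
  fixes X :: "'x set"
    and R :: "'x \<Rightarrow> 'x \<Rightarrow> 'x \<Rightarrow> bool"
    and S :: "'x \<Rightarrow> 'x \<Rightarrow> 'x \<Rightarrow> bool"
    and E :: "'x set"
  assumes R_assoc: "relationally_associative X R"
    and S_assoc: "relationally_associative X S"
    and R_units: "relational_units X R E"
    and S_units: "relational_units X S E"
    and interchange: "relational_interchange X R S"

definition sup_preserving :: "('q, 'm) gorder_scheme \<Rightarrow> ('q \<Rightarrow> 'q \<Rightarrow> 'q) \<Rightarrow> bool" where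
  "sup_preserving Q f \<longleftrightarrow>
    (\<forall>a\<in>carrier Q. \<forall>A. A \<subseteq> carrier Q \<longrightarrow>
      f a (\<Squnion>\<^bsub>Q\<^esub>A) = \<Squnion>\<^bsub>Q\<^esub>{f a b |b. b \<in> A} \<and>
      f (\<Squnion>\<^bsub>Q\<^esub>A) a = \<Squnion>\<^bsub>Q\<^esub>{f b a |b. b \<in> A})"

text \<open>
  Neither operation is assumed associative here. The case \<open>A = {}\<close> of \<^const>\<open>sup_preserving\<close> gives
  preservation of the least element.
\<close>

locale unital_double_prequantale = complete_lattice Q
  for Q :: "('q, 'm) gorder_scheme" (structure) +
  fixes bul :: "'q \<Rightarrow> 'q \<Rightarrow> 'q" (infixl \<open>\<bullet>\<close> 70)
    and dia :: "'q \<Rightarrow> 'q \<Rightarrow> 'q" (infixl \<open>\<diamondop>\<close> 70)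
    and un :: 'q
  assumes bul_closed: "\<lbrakk>a \<in> carrier Q; b \<in> carrier Q\<rbrakk> \<Longrightarrow> a \<bullet> b \<in> carrier Q"
    and dia_closed: "\<lbrakk>a \<in> carrier Q; b \<in> carrier Q\<rbrakk> \<Longrightarrow> a \<diamondop> b \<in> carrier Q"
    and bul_sup: "sup_preserving Q (\<bullet>)"
    and dia_sup: "sup_preserving Q (\<diamondop>)"
    and un_closed: "un \<in> carrier Q"
    and bul_unit_left: "a \<in> carrier Q \<Longrightarrow> un \<bullet> a = a"
    and bul_unit_right: "a \<in> carrier Q \<Longrightarrow> a \<bullet> un = a"
    and dia_unit_left: "a \<in> carrier Q \<Longrightarrow> un \<diamondop> a = a"
    and dia_unit_right: "a \<in> carrier Q \<Longrightarrow> a \<diamondop> un = a"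

locale interchange_quantale = unital_double_prequantale +
  assumes bul_assoc:
      "\<lbrakk>a \<in> carrier Q; b \<in> carrier Q; c \<in> carrier Q\<rbrakk> \<Longrightarrow> (a \<bullet> b) \<bullet> c = a \<bullet> (b \<bullet> c)"
    and dia_assoc:
      "\<lbrakk>a \<in> carrier Q; b \<in> carrier Q; c \<in> carrier Q\<rbrakk> \<Longrightarrow> (a \<diamondop> b) \<diamondop> c = a \<diamondop> (b \<diamondop> c)"
    and interchange:
      "\<lbrakk>a \<in> carrier Q; b \<in> carrier Q; c \<in> carrier Q; d \<in> carrier Q\<rbrakk> \<Longrightarrow>
        (a \<diamondop> b) \<bullet> (c \<diamondop> d) \<sqsubseteq> (a \<bullet> c) \<diamondop> (b \<bullet> d)"

text \<open>
  Functions from \<open>X\<close> to \<open>Q\<close> are represented extensionally (\<^const>\<open>undefined\<close> outside \<open>X\<close>), so that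
  equality in the function space is equality on \<open>X\<close>.
\<close>

definition function_order :: "'x set \<Rightarrow> ('q, 'm) gorder_scheme \<Rightarrow> ('x \<Rightarrow> 'q) gorder" where
  "function_order X Q =
    \<lparr>carrier = X \<rightarrow>\<^sub>E carrier Q, eq = (=), le = (\<lambda>f g. \<forall>x\<in>X. f x \<sqsubseteq>\<^bsub>Q\<^esub> g x)\<rparr>"

definition convolution ::
    "'x set \<Rightarrow> ('q, 'm) gorder_scheme \<Rightarrow> ('x \<Rightarrow> 'x \<Rightarrow> 'x \<Rightarrow> bool) \<Rightarrow> ('q \<Rightarrow> 'q \<Rightarrow> 'q) \<Rightarrow>
      ('x \<Rightarrow> 'q) \<Rightarrow> ('x \<Rightarrow> 'q) \<Rightarrow> 'x \<Rightarrow> 'q" where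
  "convolution X Q R m f g =
    (\<lambda>x\<in>X. \<Squnion>\<^bsub>Q\<^esub>{m (f y) (g z) |y z. y \<in> X \<and> z \<in> X \<and> R x y z})"

definition id_on_units ::
    "'x set \<Rightarrow> ('q, 'm) gorder_scheme \<Rightarrow> 'x set \<Rightarrow> 'q \<Rightarrow> 'x \<Rightarrow> 'q" where
  "id_on_units X Q E un = (\<lambda>x\<in>X. if x \<in> E then un else \<bottom>\<^bsub>Q\<^esub>)"

end

theory Submission
  imports Defs
begin

text \<open>
  An element of a complete lattice is determined by its upper bounds, and both the convolution and
  multiplication by a supremum have simple upper bounds; this turns every law of the convolution
  algebra into a first-order statement about the underlying relations. Conversely, the function
  with value \<open>a\<close> on \<open>A\<close> and \<open>0\<close> elsewhere is \<open>id_on_units X Q A a\<close>, and the convolution of two such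
  functions is again of this form: its support is the relational product of the supports, and its
  value is the product of the values. Taking value \<open>1\<close> and singleton supports transfers the laws of
  \<open>Q\<^sup>X\<close> to the relations. For a unit \<open>e\<close> the only relational product of \<open>e\<close> with itself is \<open>e\<close>,
  so functions supported on \<open>{e}\<close> form a copy of \<open>Q\<close> inside \<open>Q\<^sup>X\<close>.
\<close>

section \<open>Upper bounds in complete lattices and the pointwise order on functions\<close>

context complete_lattice
begin

lemma sup_le_iff:
  assumes "A \<subseteq> carrier L" "q \<in> carrier L"
  shows "\<Squnion>A \<sqsubseteq> q \<longleftrightarrow> (\<forall>a\<in>A. a \<sqsubseteq> q)"
proof
  assume "\<Squnion>A \<sqsubseteq> q"
  then show "\<forall>a\<in>A. a \<sqsubseteq> q"
    using assms sup_upper[OF assms(1)] le_trans sup_closed by (meson subsetD)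
qed (use assms in \<open>auto intro: sup_least\<close>)

text \<open>Taking \<open>q\<close> to be \<open>a\<close> and then \<open>b\<close> turns the
  equivalence into the two inequalities for antisymmetry.\<close>

lemma eq_by_upper_bounds:
  assumes "a \<in> carrier L" "b \<in> carrier L"
    and "\<And>q. q \<in> carrier L \<Longrightarrow> a \<sqsubseteq> q \<longleftrightarrow> b \<sqsubseteq> q"
  shows "a = b"
  using assms by (meson le_antisym le_refl)

lemma sup_empty: "\<Squnion>{} = \<bottom>"
  using weak_sup_empty eq_is_equal by simp

lemma partial_order_function_order: "partial_order (function_order X L)"
proof
  fix f g
  assume "f \<sqsubseteq>\<^bsub>function_order X L\<^esub> g" "g \<sqsubseteq>\<^bsub>function_order X L\<^esub> f"
    and "f \<in> carrier (function_order X L)" "g \<in> carrier (function_order X L)"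
  \<comment> \<open>Extensional functions agree outside \<open>X\<close> by definition, so
    antisymmetry at each point of \<open>X\<close> is enough for equality.\<close>
  then show "f .=\<^bsub>function_order X L\<^esub> g"
    by (auto simp: function_order_def PiE_iff intro!: extensionalityI[of f X g] le_antisym)
next
  fix f g h
  assume "f \<sqsubseteq>\<^bsub>function_order X L\<^esub> g" "g \<sqsubseteq>\<^bsub>function_order X L\<^esub> h"
    and "f \<in> carrier (function_order X L)" "g \<in> carrier (function_order X L)"
      "h \<in> carrier (function_order X L)"
  then show "f \<sqsubseteq>\<^bsub>function_order X L\<^esub> h"
    by (auto simp: function_order_def PiE_iff intro: le_trans)
qed (auto simp: function_order_def PiE_iff)

lemma least_function_order:
  assumes "F \<subseteq> X \<rightarrow>\<^sub>E carrier L"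
  shows "least (function_order X L) (\<lambda>x\<in>X. \<Squnion>{f x |f. f \<in> F}) (Upper (function_order X L) F)"
proof -
  have vals: "{f x |f. f \<in> F} \<subseteq> carrier L" if "x \<in> X" for x
    using assms that by auto
  show ?thesis
  proof (rule least_UpperI)
    fix f
    assume "f \<in> F"
    then show "f \<sqsubseteq>\<^bsub>function_order X L\<^esub> (\<lambda>x\<in>X. \<Squnion>{f x |f. f \<in> F})"
      by (auto simp: function_order_def intro!: sup_upper[OF vals])
  next
    fix g
    assume "g \<in> Upper (function_order X L) F"
    then have "g \<in> X \<rightarrow>\<^sub>E carrier L" "\<forall>f\<in>F. \<forall>x\<in>X. f x \<sqsubseteq> g x"
      using assms by (auto simp: Upper_def function_order_def)
    then show "(\<lambda>x\<in>X. \<Squnion>{f x |f. f \<in> F}) \<sqsubseteq>\<^bsub>function_order X L\<^esub> g"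
      by (auto simp: function_order_def intro!: sup_least[OF vals])
  qed (use assms sup_closed[OF vals] in \<open>auto simp: function_order_def\<close>)
qed

lemma greatest_function_order:
  assumes "F \<subseteq> X \<rightarrow>\<^sub>E carrier L"
  shows "greatest (function_order X L) (\<lambda>x\<in>X. \<Sqinter>{f x |f. f \<in> F}) (Lower (function_order X L) F)"
proof -
  have vals: "{f x |f. f \<in> F} \<subseteq> carrier L" if "x \<in> X" for x
    using assms that by auto
  show ?thesis
  proof (rule greatest_LowerI)
    fix f
    assume "f \<in> F"
    then show "(\<lambda>x\<in>X. \<Sqinter>{f x |f. f \<in> F}) \<sqsubseteq>\<^bsub>function_order X L\<^esub> f"
      by (auto simp: function_order_def intro!: inf_lower[OF vals])
  next
    fix g
    assume "g \<in> Lower (function_order X L) F"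
    then have "g \<in> X \<rightarrow>\<^sub>E carrier L" "\<forall>f\<in>F. \<forall>x\<in>X. g x \<sqsubseteq> f x"
      using assms by (auto simp: Lower_def function_order_def)
    then show "g \<sqsubseteq>\<^bsub>function_order X L\<^esub> (\<lambda>x\<in>X. \<Sqinter>{f x |f. f \<in> F})"
      by (auto simp: function_order_def intro!: inf_greatest[OF vals])
  qed (use assms inf_closed[OF vals] in \<open>auto simp: function_order_def\<close>)
qed

lemma complete_lattice_function_order: "complete_lattice (function_order X L)"
proof -
  interpret F: partial_order "function_order X L"
    by (rule partial_order_function_order)
  show ?thesis
  proof
    fix A
    assume "A \<subseteq> carrier (function_order X L)"
    then have "A \<subseteq> X \<rightarrow>\<^sub>E carrier L"
      by (simp add: function_order_def)
    then show "\<exists>s. least (function_order X L) s (Upper (function_order X L) A)"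
      "\<exists>i. greatest (function_order X L) i (Lower (function_order X L) A)"
      using least_function_order greatest_function_order by blast+
  qed
qed

text \<open>The supremum of an order is a chosen least upper bound. It is the pointwise one because
  least elements are unique up to the equivalence of the order, which here is equality.\<close>

lemma sup_function_order:
  assumes "F \<subseteq> X \<rightarrow>\<^sub>E carrier L"
  shows "\<Squnion>\<^bsub>function_order X L\<^esub>F = (\<lambda>x\<in>X. \<Squnion>{f x |f. f \<in> F})"
proof -
  interpret F: complete_lattice "function_order X L"
    by (rule complete_lattice_function_order)
  have "F \<subseteq> carrier (function_order X L)"
    using assms by (simp add: function_order_def)
  then show ?thesis
    using F.weak_least_unique[OF F.sup_lub least_function_order[OF assms]] F.eq_is_equal by simp
qed

end

text \<open>One of the two multiplications in isolation. Every law that involves a single operation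
  is proved once here and then used for both \<open>\<bullet>\<close> and
  \<open>\<diamondop>\<close>.\<close>

locale unital_prequantale = complete_lattice Q
  for Q :: "('q, 'm) gorder_scheme" (structure) +
  fixes mult :: "'q \<Rightarrow> 'q \<Rightarrow> 'q" (infixl \<open>\<cdot>\<close> 70)
    and un :: 'q
  assumes mult_closed [simp]: "\<lbrakk>a \<in> carrier Q; b \<in> carrier Q\<rbrakk> \<Longrightarrow> a \<cdot> b \<in> carrier Q"
    and mult_sup: "sup_preserving Q (\<cdot>)"
    and un_closed [simp]: "un \<in> carrier Q"
    and unit_left [simp]: "a \<in> carrier Q \<Longrightarrow> un \<cdot> a = a"
    and unit_right [simp]: "a \<in> carrier Q \<Longrightarrow> a \<cdot> un = a"
begin

lemma mult_sup_right:
  "\<lbrakk>a \<in> carrier Q; A \<subseteq> carrier Q\<rbrakk> \<Longrightarrow> a \<cdot> \<Squnion>A = \<Squnion>{a \<cdot> b |b. b \<in> A}"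
  using mult_sup by (simp add: sup_preserving_def)

lemma mult_sup_left:
  "\<lbrakk>a \<in> carrier Q; A \<subseteq> carrier Q\<rbrakk> \<Longrightarrow> \<Squnion>A \<cdot> a = \<Squnion>{b \<cdot> a |b. b \<in> A}"
  using mult_sup by (simp add: sup_preserving_def)

lemma mult_bottom_right [simp]: "a \<in> carrier Q \<Longrightarrow> a \<cdot> \<bottom> = \<bottom>"
  using mult_sup_right[of a "{}"] by (simp add: sup_empty)

lemma mult_bottom_left [simp]: "a \<in> carrier Q \<Longrightarrow> \<bottom> \<cdot> a = \<bottom>"
  using mult_sup_left[of a "{}"] by (simp add: sup_empty)

lemma mult_sup_right_le_iff:
  assumes "a \<in> carrier Q" "A \<subseteq> carrier Q" "q \<in> carrier Q"
  shows "a \<cdot> \<Squnion>A \<sqsubseteq> q \<longleftrightarrow> (\<forall>b\<in>A. a \<cdot> b \<sqsubseteq> q)"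
proof -
  have "{a \<cdot> b |b. b \<in> A} \<subseteq> carrier Q"
    using assms by auto
  then show ?thesis
    using assms by (auto simp: mult_sup_right sup_le_iff)
qed

lemma mult_sup_left_le_iff:
  assumes "a \<in> carrier Q" "A \<subseteq> carrier Q" "q \<in> carrier Q"
  shows "\<Squnion>A \<cdot> a \<sqsubseteq> q \<longleftrightarrow> (\<forall>b\<in>A. b \<cdot> a \<sqsubseteq> q)"
proof -
  have "{b \<cdot> a |b. b \<in> A} \<subseteq> carrier Q"
    using assms by auto
  then show ?thesis
    using assms by (auto simp: mult_sup_left sup_le_iff)
qed

text \<open>Preservation of suprema yields monotonicity: \<open>a \<sqsubseteq> a'\<close> makes
  \<open>a'\<close> the supremum of \<open>{a, a'}\<close>, and a product with that supremum bounds
  the product with \<open>a\<close>.\<close>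

lemma mult_mono:
  assumes "a \<sqsubseteq> a'" "b \<sqsubseteq> b'"
    and "a \<in> carrier Q" "a' \<in> carrier Q" "b \<in> carrier Q" "b' \<in> carrier Q"
  shows "a \<cdot> b \<sqsubseteq> a' \<cdot> b'"
proof -
  have sup_pair: "\<Squnion>{c, d} = d" if "c \<sqsubseteq> d" "c \<in> carrier Q" "d \<in> carrier Q" for c d
    using that by (intro eq_by_upper_bounds) (auto simp: sup_le_iff intro: le_trans)
  have "a \<cdot> b \<sqsubseteq> a' \<cdot> b"
    using mult_sup_left_le_iff[of b "{a, a'}" "a' \<cdot> b"] assms by (simp add: sup_pair)
  moreover have "a' \<cdot> b \<sqsubseteq> a' \<cdot> b'"
    using mult_sup_right_le_iff[of a' "{b, b'}" "a' \<cdot> b'"] assms by (simp add: sup_pair)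
  ultimately show ?thesis
    using assms by (meson le_trans mult_closed)
qed

section \<open>Convolution for one relation and one multiplication\<close>

lemma convolution_set_closed:
  assumes "f \<in> X \<rightarrow>\<^sub>E carrier Q" "g \<in> X \<rightarrow>\<^sub>E carrier Q"
  shows "{f y \<cdot> g z |y z. y \<in> X \<and> z \<in> X \<and> R x y z} \<subseteq> carrier Q"
  using assms by (auto simp: PiE_iff)

lemma convolution_closed:
  assumes "f \<in> X \<rightarrow>\<^sub>E carrier Q" "g \<in> X \<rightarrow>\<^sub>E carrier Q"
  shows "convolution X Q R (\<cdot>) f g \<in> X \<rightarrow>\<^sub>E carrier Q"
  unfolding convolution_def using sup_closed[OF convolution_set_closed[OF assms]] by auto

lemma convolution_le_iff:
  assumes "f \<in> X \<rightarrow>\<^sub>E carrier Q" "g \<in> X \<rightarrow>\<^sub>E carrier Q" "x \<in> X" "q \<in> carrier Q"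
  shows "convolution X Q R (\<cdot>) f g x \<sqsubseteq> q \<longleftrightarrow>
    (\<forall>y\<in>X. \<forall>z\<in>X. R x y z \<longrightarrow> f y \<cdot> g z \<sqsubseteq> q)"
  using assms by (simp add: convolution_def sup_le_iff[OF convolution_set_closed]) blast

text \<open>The outer multiplication \<open>m\<close> may differ from the one inside the
  convolution. Associativity takes both equal; interchange multiplies
  \<open>\<diamondop>\<close>-convolutions by \<open>\<bullet>\<close>.\<close>

lemma mult_convolution_le_iff:
  assumes "f \<in> X \<rightarrow>\<^sub>E carrier Q" "g \<in> X \<rightarrow>\<^sub>E carrier Q" "x \<in> X" "q \<in> carrier Q"
    and "unital_prequantale Q m un'" "a \<in> carrier Q"
  shows "m a (convolution X Q R (\<cdot>) f g x) \<sqsubseteq> q \<longleftrightarrow>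
    (\<forall>y\<in>X. \<forall>z\<in>X. R x y z \<longrightarrow> m a (f y \<cdot> g z) \<sqsubseteq> q)"
proof -
  interpret m: unital_prequantale Q m un'
    by fact
  show ?thesis
    using assms
    by (simp add: convolution_def m.mult_sup_right_le_iff[OF _ convolution_set_closed]) blast
qed

lemma convolution_mult_le_iff:
  assumes "f \<in> X \<rightarrow>\<^sub>E carrier Q" "g \<in> X \<rightarrow>\<^sub>E carrier Q" "x \<in> X" "q \<in> carrier Q"
    and "unital_prequantale Q m un'" "a \<in> carrier Q"
  shows "m (convolution X Q R (\<cdot>) f g x) a \<sqsubseteq> q \<longleftrightarrow>
    (\<forall>y\<in>X. \<forall>z\<in>X. R x y z \<longrightarrow> m (f y \<cdot> g z) a \<sqsubseteq> q)"
proof -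
  interpret m: unital_prequantale Q m un'
    by fact
  show ?thesis
    using assms
    by (simp add: convolution_def m.mult_sup_left_le_iff[OF _ convolution_set_closed]) blast
qed

lemma convolution_upper:
  assumes "f \<in> X \<rightarrow>\<^sub>E carrier Q" "g \<in> X \<rightarrow>\<^sub>E carrier Q" "x \<in> X" "y \<in> X" "z \<in> X" "R x y z"
  shows "f y \<cdot> g z \<sqsubseteq> convolution X Q R (\<cdot>) f g x"
proof -
  have "convolution X Q R (\<cdot>) f g x \<in> carrier Q"
    using convolution_closed[OF assms(1,2)] assms(3) by (rule PiE_mem)
  then show ?thesis
    using convolution_le_iff[OF assms(1-3), where q = "convolution X Q R (\<cdot>) f g x" and R = R]
      assms(4-6) by simp
qed

lemma function_eqI:
  assumes "f \<in> X \<rightarrow>\<^sub>E carrier Q" "g \<in> X \<rightarrow>\<^sub>E carrier Q"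
    and "\<And>x q. \<lbrakk>x \<in> X; q \<in> carrier Q\<rbrakk> \<Longrightarrow> f x \<sqsubseteq> q \<longleftrightarrow> g x \<sqsubseteq> q"
  shows "f = g"
  using assms by (intro PiE_ext[OF assms(1,2)] eq_by_upper_bounds) (auto simp: PiE_iff)

lemma convolution_assoc:
  assumes R: "relationally_associative X R"
    and assoc: "\<And>a b c. \<lbrakk>a \<in> carrier Q; b \<in> carrier Q; c \<in> carrier Q\<rbrakk> \<Longrightarrow>
      (a \<cdot> b) \<cdot> c = a \<cdot> (b \<cdot> c)"
    and fgh: "f \<in> X \<rightarrow>\<^sub>E carrier Q" "g \<in> X \<rightarrow>\<^sub>E carrier Q" "h \<in> X \<rightarrow>\<^sub>E carrier Q"
  shows "convolution X Q R (\<cdot>) (convolution X Q R (\<cdot>) f g) h =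
    convolution X Q R (\<cdot>) f (convolution X Q R (\<cdot>) g h)"
proof (rule function_eqI)
  fix x q
  assume xq: "x \<in> X" "q \<in> carrier Q"
  note up = unital_prequantale_axioms
  have mem: "f u \<in> carrier Q" "g u \<in> carrier Q" "h u \<in> carrier Q" if "u \<in> X" for u
    using fgh that by auto
  have "convolution X Q R (\<cdot>) (convolution X Q R (\<cdot>) f g) h x \<sqsubseteq> q \<longleftrightarrow>
      (\<forall>y\<in>X. \<forall>w\<in>X. R x y w \<longrightarrow>
        (\<forall>u\<in>X. \<forall>v\<in>X. R y u v \<longrightarrow> (f u \<cdot> g v) \<cdot> h w \<sqsubseteq> q))"
    using xq fgh mem
    by (simp add: convolution_le_iff convolution_closed convolution_mult_le_iff[OF _ _ _ _ up])
  \<comment> \<open>The intermediate point \<open>y\<close> occurs only in the relations, so its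
    quantifier moves into the premise and forms one side of relational associativity.\<close>
  also have "\<dots> \<longleftrightarrow> (\<forall>u\<in>X. \<forall>v\<in>X. \<forall>w\<in>X.
      (\<exists>y\<in>X. R y u v \<and> R x y w) \<longrightarrow> (f u \<cdot> g v) \<cdot> h w \<sqsubseteq> q)"
    by blast
  also have "\<dots> \<longleftrightarrow> (\<forall>u\<in>X. \<forall>v\<in>X. \<forall>w\<in>X.
      (\<exists>y\<in>X. R x u y \<and> R y v w) \<longrightarrow> f u \<cdot> (g v \<cdot> h w) \<sqsubseteq> q)"
    using R xq(1) mem by (simp add: relationally_associative_def assoc)
  also have "\<dots> \<longleftrightarrow> (\<forall>u\<in>X. \<forall>y\<in>X. R x u y \<longrightarrow>
      (\<forall>v\<in>X. \<forall>w\<in>X. R y v w \<longrightarrow> f u \<cdot> (g v \<cdot> h w) \<sqsubseteq> q))"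
    by blast
  also have "\<dots> \<longleftrightarrow> convolution X Q R (\<cdot>) f (convolution X Q R (\<cdot>) g h) x \<sqsubseteq> q"
    using xq fgh mem
    by (simp add: convolution_le_iff convolution_closed mult_convolution_le_iff[OF _ _ _ _ up])
  finally show "convolution X Q R (\<cdot>) (convolution X Q R (\<cdot>) f g) h x \<sqsubseteq> q \<longleftrightarrow>
      convolution X Q R (\<cdot>) f (convolution X Q R (\<cdot>) g h) x \<sqsubseteq> q" .
qed (use fgh in \<open>auto intro!: convolution_closed\<close>)

lemma id_on_units_closed: "a \<in> carrier Q \<Longrightarrow> id_on_units X Q A a \<in> X \<rightarrow>\<^sub>E carrier Q"
  by (simp add: id_on_units_def)

lemma convolution_unit_left:
  assumes R: "relational_units X R E" and f: "f \<in> X \<rightarrow>\<^sub>E carrier Q"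
  shows "convolution X Q R (\<cdot>) (id_on_units X Q E un) f = f"
proof (rule function_eqI)
  fix x q
  assume xq: "x \<in> X" "q \<in> carrier Q"
  \<comment> \<open>For \<open>y\<close> outside \<open>E\<close> the product is the least element,
    so it imposes no condition on \<open>q\<close>.\<close>
  have prod: "id_on_units X Q E un y \<cdot> f z \<sqsubseteq> q \<longleftrightarrow> (y \<in> E \<longrightarrow> f z \<sqsubseteq> q)"
    if "y \<in> X" "z \<in> X" for y z
    using PiE_mem[OF f that(2)] that xq(2) by (simp add: id_on_units_def)
  have "convolution X Q R (\<cdot>) (id_on_units X Q E un) f x \<sqsubseteq> q \<longleftrightarrow>
      (\<forall>y\<in>X. \<forall>z\<in>X. R x y z \<longrightarrow> y \<in> E \<longrightarrow> f z \<sqsubseteq> q)"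
    unfolding convolution_le_iff[OF id_on_units_closed[OF un_closed] f xq] using prod by blast
  \<comment> \<open>With \<open>y\<close> in \<open>E\<close>, the relation forces
    \<open>z = x\<close>, and some unit does relate \<open>x\<close> to itself; the only condition
    left is the one for \<open>f x\<close>.\<close>
  also have "\<dots> \<longleftrightarrow> f x \<sqsubseteq> q"
    using R xq(1) unfolding relational_units_def by blast
  finally show "convolution X Q R (\<cdot>) (id_on_units X Q E un) f x \<sqsubseteq> q \<longleftrightarrow> f x \<sqsubseteq> q" .
qed (use f in \<open>auto intro!: convolution_closed id_on_units_closed\<close>)

lemma convolution_unit_right:
  assumes R: "relational_units X R E" and f: "f \<in> X \<rightarrow>\<^sub>E carrier Q"
  shows "convolution X Q R (\<cdot>) f (id_on_units X Q E un) = f"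
proof (rule function_eqI)
  fix x q
  assume xq: "x \<in> X" "q \<in> carrier Q"
  have prod: "f y \<cdot> id_on_units X Q E un z \<sqsubseteq> q \<longleftrightarrow> (z \<in> E \<longrightarrow> f y \<sqsubseteq> q)"
    if "y \<in> X" "z \<in> X" for y z
    using PiE_mem[OF f that(1)] that xq(2) by (simp add: id_on_units_def)
  have "convolution X Q R (\<cdot>) f (id_on_units X Q E un) x \<sqsubseteq> q \<longleftrightarrow>
      (\<forall>y\<in>X. \<forall>z\<in>X. R x y z \<longrightarrow> z \<in> E \<longrightarrow> f y \<sqsubseteq> q)"
    unfolding convolution_le_iff[OF f id_on_units_closed[OF un_closed] xq] using prod by blast
  also have "\<dots> \<longleftrightarrow> f x \<sqsubseteq> q"
    using R xq(1) unfolding relational_units_def by blast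
  finally show "convolution X Q R (\<cdot>) f (id_on_units X Q E un) x \<sqsubseteq> q \<longleftrightarrow> f x \<sqsubseteq> q" .
qed (use f in \<open>auto intro!: convolution_closed id_on_units_closed\<close>)

text \<open>Suprema of functions are pointwise, so bounding either side means bounding all products
  over members of \<open>F\<close> and decompositions of \<open>x\<close>; the two sides differ only
  in the order of these quantifiers.\<close>

lemma sup_preserving_convolution:
  "sup_preserving (function_order X Q) (convolution X Q R (\<cdot>))"
  unfolding sup_preserving_def
proof (intro ballI allI impI)
  fix f F
  let ?O = "function_order X Q" and ?c = "convolution X Q R (\<cdot>)"
  assume "f \<in> carrier ?O" "F \<subseteq> carrier ?O"
  then have f: "f \<in> X \<rightarrow>\<^sub>E carrier Q" and F: "F \<subseteq> X \<rightarrow>\<^sub>E carrier Q"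
    by (simp_all add: function_order_def)
  have memf: "f z \<in> carrier Q" if "z \<in> X" for z
    using f that by auto
  have memF: "g z \<in> carrier Q" if "g \<in> F" "z \<in> X" for g z
    using F that by auto
  have vals: "{g z |g. g \<in> F} \<subseteq> carrier Q" if "z \<in> X" for z
    using memF that by auto
  have supF: "\<Squnion>\<^bsub>?O\<^esub>F \<in> X \<rightarrow>\<^sub>E carrier Q"
    using vals by (simp add: sup_function_order[OF F])
  have "?c f (\<Squnion>\<^bsub>?O\<^esub>F) = \<Squnion>\<^bsub>?O\<^esub>{?c f g |g. g \<in> F}"
  proof -
    have C: "{?c f g |g. g \<in> F} \<subseteq> X \<rightarrow>\<^sub>E carrier Q"
      using subsetD[OF F] f by (auto intro!: convolution_closed)
    \<comment> \<open>The nested comprehension is the form in which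
      \<open>sup_function_order\<close> presents the values of this family at
      \<open>x\<close>.\<close>
    have valsC: "{h x |h. h \<in> {?c f g |g. g \<in> F}} \<subseteq> carrier Q" if "x \<in> X" for x
      using PiE_mem[OF subsetD[OF C] that] by blast
    show ?thesis
    proof (rule function_eqI)
      fix x q
      assume xq: "x \<in> X" "q \<in> carrier Q"
      have "?c f (\<Squnion>\<^bsub>?O\<^esub>F) x \<sqsubseteq> q \<longleftrightarrow>
          (\<forall>y\<in>X. \<forall>z\<in>X. R x y z \<longrightarrow> (\<forall>b\<in>{g z |g. g \<in> F}. f y \<cdot> b \<sqsubseteq> q))"
        unfolding convolution_le_iff[OF f supF xq]
        using xq memf vals by (simp add: sup_function_order[OF F] mult_sup_right_le_iff)
      also have "\<dots> \<longleftrightarrow> (\<forall>g\<in>F. \<forall>y\<in>X. \<forall>z\<in>X. R x y z \<longrightarrow> f y \<cdot> g z \<sqsubseteq> q)"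
        by blast
      also have "\<dots> \<longleftrightarrow> (\<forall>g\<in>F. ?c f g x \<sqsubseteq> q)"
        using convolution_le_iff[OF f subsetD[OF F] xq] by simp
      also have "\<dots> \<longleftrightarrow> (\<Squnion>\<^bsub>?O\<^esub>{?c f g |g. g \<in> F}) x \<sqsubseteq> q"
        unfolding sup_function_order[OF C] restrict_apply'[OF xq(1)]
          sup_le_iff[OF valsC[OF xq(1)] xq(2)]
        by blast
      finally show "?c f (\<Squnion>\<^bsub>?O\<^esub>F) x \<sqsubseteq> q \<longleftrightarrow> (\<Squnion>\<^bsub>?O\<^esub>{?c f g |g. g \<in> F}) x \<sqsubseteq> q" .
    next
      show "\<Squnion>\<^bsub>?O\<^esub>{?c f g |g. g \<in> F} \<in> X \<rightarrow>\<^sub>E carrier Q"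
        unfolding sup_function_order[OF C] using sup_closed[OF valsC] by auto
    qed (rule convolution_closed[OF f supF])
  qed
  moreover have "?c (\<Squnion>\<^bsub>?O\<^esub>F) f = \<Squnion>\<^bsub>?O\<^esub>{?c g f |g. g \<in> F}"
  proof -
    have C: "{?c g f |g. g \<in> F} \<subseteq> X \<rightarrow>\<^sub>E carrier Q"
      using subsetD[OF F] f by (auto intro!: convolution_closed)
    have valsC: "{h x |h. h \<in> {?c g f |g. g \<in> F}} \<subseteq> carrier Q" if "x \<in> X" for x
      using PiE_mem[OF subsetD[OF C] that] by blast
    show ?thesis
    proof (rule function_eqI)
      fix x q
      assume xq: "x \<in> X" "q \<in> carrier Q"
      have "?c (\<Squnion>\<^bsub>?O\<^esub>F) f x \<sqsubseteq> q \<longleftrightarrow>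
          (\<forall>y\<in>X. \<forall>z\<in>X. R x y z \<longrightarrow> (\<forall>b\<in>{g y |g. g \<in> F}. b \<cdot> f z \<sqsubseteq> q))"
        unfolding convolution_le_iff[OF supF f xq]
        using xq memf vals by (simp add: sup_function_order[OF F] mult_sup_left_le_iff)
      also have "\<dots> \<longleftrightarrow> (\<forall>g\<in>F. \<forall>y\<in>X. \<forall>z\<in>X. R x y z \<longrightarrow> g y \<cdot> f z \<sqsubseteq> q)"
        by blast
      also have "\<dots> \<longleftrightarrow> (\<forall>g\<in>F. ?c g f x \<sqsubseteq> q)"
        using convolution_le_iff[OF subsetD[OF F] f xq] by simp
      also have "\<dots> \<longleftrightarrow> (\<Squnion>\<^bsub>?O\<^esub>{?c g f |g. g \<in> F}) x \<sqsubseteq> q"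
        unfolding sup_function_order[OF C] restrict_apply'[OF xq(1)]
          sup_le_iff[OF valsC[OF xq(1)] xq(2)]
        by blast
      finally show "?c (\<Squnion>\<^bsub>?O\<^esub>F) f x \<sqsubseteq> q \<longleftrightarrow> (\<Squnion>\<^bsub>?O\<^esub>{?c g f |g. g \<in> F}) x \<sqsubseteq> q" .
    next
      show "\<Squnion>\<^bsub>?O\<^esub>{?c g f |g. g \<in> F} \<in> X \<rightarrow>\<^sub>E carrier Q"
        unfolding sup_function_order[OF C] using sup_closed[OF valsC] by auto
    qed (rule convolution_closed[OF supF f])
  qed
  ultimately show "?c f (\<Squnion>\<^bsub>?O\<^esub>F) = \<Squnion>\<^bsub>?O\<^esub>{?c f g |g. g \<in> F} \<and>
      ?c (\<Squnion>\<^bsub>?O\<^esub>F) f = \<Squnion>\<^bsub>?O\<^esub>{?c g f |g. g \<in> F}" ..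
qed

section \<open>Recovering relations from functions with constant value on a support\<close>

text \<open>Products with a factor outside its support are the least element. All others equal
  \<open>a \<cdot> b\<close>, so only the existence of a decomposition into the two supports
  matters. \<open>A\<close> and \<open>B\<close> need not lie in \<open>X\<close>, hence the
  intersections.\<close>

lemma convolution_id_on_units:
  assumes "a \<in> carrier Q" "b \<in> carrier Q"
  shows "convolution X Q R (\<cdot>) (id_on_units X Q A a) (id_on_units X Q B b) =
    id_on_units X Q {x. \<exists>y\<in>X \<inter> A. \<exists>z\<in>X \<inter> B. R x y z} (a \<cdot> b)"
proof (rule function_eqI)
  fix x q
  let ?P = "{x. \<exists>y\<in>X \<inter> A. \<exists>z\<in>X \<inter> B. R x y z}"
  assume xq: "x \<in> X" "q \<in> carrier Q"
  have prod: "id_on_units X Q A a y \<cdot> id_on_units X Q B b z \<sqsubseteq> q \<longleftrightarrow>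
      (y \<in> A \<longrightarrow> z \<in> B \<longrightarrow> a \<cdot> b \<sqsubseteq> q)" if "y \<in> X" "z \<in> X" for y z
    using that xq(2) assms by (simp add: id_on_units_def)
  have "id_on_units X Q ?P (a \<cdot> b) x \<sqsubseteq> q \<longleftrightarrow> (x \<in> ?P \<longrightarrow> a \<cdot> b \<sqsubseteq> q)"
    using xq by (simp add: id_on_units_def)
  then show "convolution X Q R (\<cdot>) (id_on_units X Q A a) (id_on_units X Q B b) x \<sqsubseteq> q \<longleftrightarrow>
      id_on_units X Q ?P (a \<cdot> b) x \<sqsubseteq> q"
    unfolding convolution_le_iff[OF assms[THEN id_on_units_closed] xq] using prod by blast
qed (use assms in \<open>auto intro!: convolution_closed id_on_units_closed\<close>)

text \<open>At a point of \<open>X\<close> in \<open>A\<close> but not in \<open>B\<close> the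
  inequality would read \<open>un \<sqsubseteq> \<bottom>\<close>, contrary to
  \<open>un \<noteq> \<bottom>\<close>. This is where \<open>1 \<noteq> 0\<close> makes supports
  visible.\<close>

lemma id_on_units_le_iff:
  assumes "un \<noteq> \<bottom>"
  shows "id_on_units X Q A un \<sqsubseteq>\<^bsub>function_order X Q\<^esub> id_on_units X Q B un \<longleftrightarrow> X \<inter> A \<subseteq> B"
proof -
  have "\<not> un \<sqsubseteq> \<bottom>"
    using assms by (meson bottom_closed bottom_lower le_antisym un_closed)
  then show ?thesis
    by (auto simp: id_on_units_def function_order_def)
qed

lemma id_on_units_eq_iff:
  assumes "un \<noteq> \<bottom>"
  shows "id_on_units X Q A un = id_on_units X Q B un \<longleftrightarrow> X \<inter> A = X \<inter> B"
proof
  assume eq: "id_on_units X Q A un = id_on_units X Q B un"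
  have "x \<in> A \<longleftrightarrow> x \<in> B" if "x \<in> X" for x
    using fun_cong[OF eq, of x] that assms by (auto simp: id_on_units_def split: if_splits)
  then show "X \<inter> A = X \<inter> B"
    by blast
qed (auto simp: id_on_units_def fun_eq_iff restrict_def)

lemma relationally_associative_if_convolution_assoc:
  assumes "un \<noteq> \<bottom>"
    and "\<And>f g h. \<lbrakk>f \<in> X \<rightarrow>\<^sub>E carrier Q; g \<in> X \<rightarrow>\<^sub>E carrier Q; h \<in> X \<rightarrow>\<^sub>E carrier Q\<rbrakk> \<Longrightarrow>
      convolution X Q R (\<cdot>) (convolution X Q R (\<cdot>) f g) h =
      convolution X Q R (\<cdot>) f (convolution X Q R (\<cdot>) g h)"
  shows "relationally_associative X R"
  unfolding relationally_associative_def
proof (intro ballI)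
  fix x u v w
  assume *: "x \<in> X" "u \<in> X" "v \<in> X" "w \<in> X"
  let ?d = "\<lambda>u. id_on_units X Q {u} un"
  have "convolution X Q R (\<cdot>) (convolution X Q R (\<cdot>) (?d u) (?d v)) (?d w) =
      convolution X Q R (\<cdot>) (?d u) (convolution X Q R (\<cdot>) (?d v) (?d w))"
    by (intro assms(2) id_on_units_closed un_closed)
  \<comment> \<open>All values collapse to \<open>un\<close> by \<open>un \<cdot> un = un\<close>,
    so the equation of functions becomes an equation of supports, which is then read at
    \<open>x\<close>.\<close>
  from this[simplified convolution_id_on_units un_closed unit_left id_on_units_eq_iff[OF assms(1)]]
  show "(\<exists>y\<in>X. R y u v \<and> R x y w) \<longleftrightarrow> (\<exists>y\<in>X. R x u y \<and> R y v w)"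
    using * unfolding set_eq_iff by auto
qed

lemma relational_units_if_convolution_units:
  assumes "un \<noteq> \<bottom>" "E \<subseteq> X"
    and "\<And>f. f \<in> X \<rightarrow>\<^sub>E carrier Q \<Longrightarrow> convolution X Q R (\<cdot>) (id_on_units X Q E un) f = f"
    and "\<And>f. f \<in> X \<rightarrow>\<^sub>E carrier Q \<Longrightarrow> convolution X Q R (\<cdot>) f (id_on_units X Q E un) = f"
  shows "relational_units X R E"
proof -
  let ?d = "\<lambda>u. id_on_units X Q {u} un"
  \<comment> \<open>This equivalence packs both left unit axioms: \<open>y = x\<close> gives
    existence, and the forward direction gives uniqueness. It says that the relational product of
    \<open>E\<close> and \<open>{y}\<close> is \<open>{y}\<close>.\<close>
  have left: "(\<exists>e\<in>E. R x e y) \<longleftrightarrow> x = y" if "x \<in> X" "y \<in> X" for x y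
  proof -
    have "convolution X Q R (\<cdot>) (id_on_units X Q E un) (?d y) = ?d y"
      by (intro assms(3) id_on_units_closed un_closed)
    from this[simplified convolution_id_on_units un_closed unit_left id_on_units_eq_iff[OF assms(1)]]
    show ?thesis
      using that assms(2) unfolding set_eq_iff by auto
  qed
  have right: "(\<exists>e\<in>E. R x y e) \<longleftrightarrow> x = y" if "x \<in> X" "y \<in> X" for x y
  proof -
    have "convolution X Q R (\<cdot>) (?d y) (id_on_units X Q E un) = ?d y"
      by (intro assms(4) id_on_units_closed un_closed)
    from this[simplified convolution_id_on_units un_closed unit_left id_on_units_eq_iff[OF assms(1)]]
    show ?thesis
      using that assms(2) unfolding set_eq_iff by auto
  qed
  show ?thesis
    unfolding relational_units_def using assms(2) left right by blast
qed

lemma convolution_at_unit: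
  assumes "relational_units X R E" "e \<in> E" "a \<in> carrier Q" "b \<in> carrier Q"
  shows "convolution X Q R (\<cdot>) (id_on_units X Q {e} a) (id_on_units X Q {e} b) =
    id_on_units X Q {e} (a \<cdot> b)"
proof -
  have "e \<in> X"
    using assms(1,2) by (auto simp: relational_units_def)
  \<comment> \<open>Some unit \<open>e'\<close> satisfies \<open>R e e' e\<close>. Since
    \<open>e\<close> is itself a right unit, \<open>e' = e\<close>, whence \<open>R e e e\<close>;
    conversely \<open>R x e e\<close> gives \<open>x = e\<close>.\<close>
  moreover have "R x e e \<longleftrightarrow> x = e" if "x \<in> X" for x
    using assms(1,2) that \<open>e \<in> X\<close> unfolding relational_units_def by (metis subsetD)
  ultimately show ?thesis
    using assms(3,4) by (auto simp: convolution_id_on_units) (auto simp: id_on_units_def fun_eq_iff)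
qed

end

section \<open>Two multiplications and the interchange law\<close>

context unital_double_prequantale
begin

sublocale bul: unital_prequantale Q bul un
  by unfold_locales
    (simp_all add: bul_closed bul_sup un_closed bul_unit_left bul_unit_right)

sublocale dia: unital_prequantale Q dia un
  by unfold_locales
    (simp_all add: dia_closed dia_sup un_closed dia_unit_left dia_unit_right)

lemma convolution_interchange:
  assumes RS: "relational_interchange X R S"
    and interchange: "\<And>a b c d. \<lbrakk>a \<in> carrier Q; b \<in> carrier Q; c \<in> carrier Q; d \<in> carrier Q\<rbrakk> \<Longrightarrow>
      (a \<diamondop> b) \<bullet> (c \<diamondop> d) \<sqsubseteq> (a \<bullet> c) \<diamondop> (b \<bullet> d)"
    and fghk: "f \<in> X \<rightarrow>\<^sub>E carrier Q" "g \<in> X \<rightarrow>\<^sub>E carrier Q" "h \<in> X \<rightarrow>\<^sub>E carrier Q"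
      "k \<in> X \<rightarrow>\<^sub>E carrier Q"
    and x: "x \<in> X"
  shows "convolution X Q R (\<bullet>) (convolution X Q S (\<diamondop>) f g) (convolution X Q S (\<diamondop>) h k) x \<sqsubseteq>
    convolution X Q S (\<diamondop>) (convolution X Q R (\<bullet>) f h) (convolution X Q R (\<bullet>) g k) x"
    (is "_ \<sqsubseteq> ?q")
proof -
  let ?r = "convolution X Q R (\<bullet>)" and ?s = "convolution X Q S (\<diamondop>)"
  note r = bul.convolution_closed[of _ X _ R] and s = dia.convolution_closed[of _ X _ S]
  have mem: "f y \<in> carrier Q" "g y \<in> carrier Q" "h y \<in> carrier Q" "k y \<in> carrier Q"
    "?r f h y \<in> carrier Q" "?r g k y \<in> carrier Q" "?s h k y \<in> carrier Q" if "y \<in> X" for y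
    using fghk[THEN PiE_mem] r[OF fghk(1,3), THEN PiE_mem] r[OF fghk(2,4), THEN PiE_mem]
      s[OF fghk(3,4), THEN PiE_mem] that
    by simp_all
  have q: "?q \<in> carrier Q"
    using s[OF r[OF fghk(1,3)] r[OF fghk(2,4)]] x by (rule PiE_mem)
  \<comment> \<open>Upper bounds reduce the claim to these elementary products, one for each double
    decomposition of \<open>x\<close>. Relational interchange regroups the decomposition, and the
    interchange law of \<open>Q\<close> regroups the product accordingly.\<close>
  have "(f t \<diamondop> g u) \<bullet> (h v \<diamondop> k w) \<sqsubseteq> ?q"
    if X: "t \<in> X" "u \<in> X" "v \<in> X" "w \<in> X" "y \<in> X" "z \<in> X"
      and yz: "R x y z" "S y t u" "S z v w" for t u v w y z
  proof -
    obtain y' z' where y'z': "y' \<in> X" "z' \<in> X" "R y' t v" "S x y' z'" "R z' u w"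
      using RS X yz x unfolding relational_interchange_def by blast
    have "(f t \<diamondop> g u) \<bullet> (h v \<diamondop> k w) \<sqsubseteq> (f t \<bullet> h v) \<diamondop> (g u \<bullet> k w)"
      using X mem by (intro interchange)
    also have "\<dots> \<sqsubseteq> ?r f h y' \<diamondop> ?r g k z'"
      using X y'z' mem fghk by (intro dia.mult_mono bul.convolution_upper bul.mult_closed)
    also have "\<dots> \<sqsubseteq> ?q"
      using y'z' fghk x by (intro dia.convolution_upper r)
    finally show ?thesis
      using X y'z' mem q by simp
  qed
  then show ?thesis
    unfolding bul.convolution_le_iff[OF s[OF fghk(1,2)] s[OF fghk(3,4)] x q]
    using q fghk mem
    by (simp add:
        dia.convolution_mult_le_iff[OF _ _ _ _ bul.unital_prequantale_axioms]
        dia.mult_convolution_le_iff[OF _ _ _ _ bul.unital_prequantale_axioms])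
qed

text \<open>For functions with value \<open>un\<close> on single points, both sides again have value
  \<open>un\<close> on their supports; the inequality becomes an inclusion of supports, which is
  relational interchange at the chosen points.\<close>

lemma relational_interchange_if_convolution_interchange:
  assumes "un \<noteq> \<bottom>"
    and "\<And>f g h k. \<lbrakk>f \<in> X \<rightarrow>\<^sub>E carrier Q; g \<in> X \<rightarrow>\<^sub>E carrier Q; h \<in> X \<rightarrow>\<^sub>E carrier Q;
        k \<in> X \<rightarrow>\<^sub>E carrier Q\<rbrakk> \<Longrightarrow>
      convolution X Q R (\<bullet>) (convolution X Q S (\<diamondop>) f g) (convolution X Q S (\<diamondop>) h k)
        \<sqsubseteq>\<^bsub>function_order X Q\<^esub>
      convolution X Q S (\<diamondop>) (convolution X Q R (\<bullet>) f h) (convolution X Q R (\<bullet>) g k)"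
  shows "relational_interchange X R S"
  unfolding relational_interchange_def
proof (intro ballI)
  fix t u v w x
  assume *: "t \<in> X" "u \<in> X" "v \<in> X" "w \<in> X" "x \<in> X"
  let ?d = "\<lambda>u. id_on_units X Q {u} un"
  have "convolution X Q R (\<bullet>) (convolution X Q S (\<diamondop>) (?d t) (?d u))
        (convolution X Q S (\<diamondop>) (?d v) (?d w)) \<sqsubseteq>\<^bsub>function_order X Q\<^esub>
      convolution X Q S (\<diamondop>) (convolution X Q R (\<bullet>) (?d t) (?d v))
        (convolution X Q R (\<bullet>) (?d u) (?d w))"
    by (intro assms(2) bul.id_on_units_closed un_closed)
  from this[simplified bul.convolution_id_on_units dia.convolution_id_on_units un_closed
      bul_unit_left dia_unit_left bul.id_on_units_le_iff[OF assms(1)]]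
  show "(\<exists>y\<in>X. \<exists>z\<in>X. S y t u \<and> R x y z \<and> S z v w) \<longrightarrow>
      (\<exists>y\<in>X. \<exists>z\<in>X. R y t v \<and> S x y z \<and> R z u w)"
    using * by blast
qed

section \<open>The three implications\<close>

lemma interchange_quantale_function_order:
  assumes "relational_interchange_monoid X R S E" "interchange_quantale Q (\<bullet>) (\<diamondop>) un"
  shows "interchange_quantale (function_order X Q)
    (convolution X Q R (\<bullet>)) (convolution X Q S (\<diamondop>)) (id_on_units X Q E un)"
proof -
  interpret X: relational_interchange_monoid X R S E
    by fact
  interpret Q: interchange_quantale Q "(\<bullet>)" "(\<diamondop>)" un
    by fact
  interpret F: complete_lattice "function_order X Q"
    by (rule complete_lattice_function_order)
  have carrier: "carrier (function_order X Q) = X \<rightarrow>\<^sub>E carrier Q"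
    by (simp add: function_order_def)
  show ?thesis
  proof (unfold_locales, unfold carrier)
    fix f g h k
    assume "f \<in> X \<rightarrow>\<^sub>E carrier Q" "g \<in> X \<rightarrow>\<^sub>E carrier Q" "h \<in> X \<rightarrow>\<^sub>E carrier Q"
      "k \<in> X \<rightarrow>\<^sub>E carrier Q"
    then show "convolution X Q R (\<bullet>) (convolution X Q S (\<diamondop>) f g) (convolution X Q S (\<diamondop>) h k)
        \<sqsubseteq>\<^bsub>function_order X Q\<^esub>
      convolution X Q S (\<diamondop>) (convolution X Q R (\<bullet>) f h) (convolution X Q R (\<bullet>) g k)"
      using convolution_interchange[OF X.interchange Q.interchange]
      by (simp add: function_order_def)
  qed (simp_all add: bul.convolution_closed dia.convolution_closed
      bul.sup_preserving_convolution dia.sup_preserving_convolution bul.id_on_units_closed un_closed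
      bul.convolution_unit_left[OF X.R_units] bul.convolution_unit_right[OF X.R_units]
      dia.convolution_unit_left[OF X.S_units] dia.convolution_unit_right[OF X.S_units]
      bul.convolution_assoc[OF X.R_assoc Q.bul_assoc]
      dia.convolution_assoc[OF X.S_assoc Q.dia_assoc])
qed

lemma relational_interchange_monoid_if_function_order:
  assumes "interchange_quantale (function_order X Q)
      (convolution X Q R (\<bullet>)) (convolution X Q S (\<diamondop>)) (id_on_units X Q E un)"
    and "un \<noteq> \<bottom>" "E \<subseteq> X"
  shows "relational_interchange_monoid X R S E"
proof -
  interpret F: interchange_quantale "function_order X Q"
    "convolution X Q R (\<bullet>)" "convolution X Q S (\<diamondop>)" "id_on_units X Q E un"
    by fact
  have carrier: "carrier (function_order X Q) = X \<rightarrow>\<^sub>E carrier Q"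
    by (simp add: function_order_def)
  show ?thesis
  proof
    show "relationally_associative X R"
      using F.bul_assoc assms(2) unfolding carrier
      by (rule bul.relationally_associative_if_convolution_assoc[rotated])
    show "relationally_associative X S"
      using F.dia_assoc assms(2) unfolding carrier
      by (rule dia.relationally_associative_if_convolution_assoc[rotated])
    show "relational_units X R E"
      using assms(2,3) F.bul_unit_left F.bul_unit_right unfolding carrier
      by (rule bul.relational_units_if_convolution_units)
    show "relational_units X S E"
      using assms(2,3) F.dia_unit_left F.dia_unit_right unfolding carrier
      by (rule dia.relational_units_if_convolution_units)
    show "relational_interchange X R S"
      using assms(2) F.interchange unfolding carrier
      by (rule relational_interchange_if_convolution_interchange)
  qed
qed

text \<open>Here \<open>a = un \<bullet> a = \<bottom>\<close> for every \<open>a\<close>, so the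
  carrier is a single point and all laws hold. This covers the case of the third implication in
  which supports cannot be read off from functions.\<close>

lemma interchange_quantale_if_trivial:
  assumes "un = \<bottom>"
  shows "interchange_quantale Q (\<bullet>) (\<diamondop>) un"
proof -
  have bot: "a = \<bottom>" if "a \<in> carrier Q" for a
    using bul_unit_left[OF that] bul.mult_bottom_left[OF that] assms by simp
  have eq: "a = b" if "a \<in> carrier Q" "b \<in> carrier Q" for a b
    using bot[OF that(1)] bot[OF that(2)] by simp
  show ?thesis
  proof
    fix a b c d
    assume "a \<in> carrier Q" "b \<in> carrier Q" "c \<in> carrier Q" "d \<in> carrier Q"
    then have "(a \<diamondop> b) \<bullet> (c \<diamondop> d) = (a \<bullet> c) \<diamondop> (b \<bullet> d)" "(a \<bullet> c) \<diamondop> (b \<bullet> d) \<in> carrier Q"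
      by (auto intro!: eq bul_closed dia_closed)
    then show "(a \<diamondop> b) \<bullet> (c \<diamondop> d) \<sqsubseteq> (a \<bullet> c) \<diamondop> (b \<bullet> d)"
      by simp
  qed (auto intro!: eq bul_closed dia_closed)
qed

lemma interchange_quantale_if_function_order:
  assumes F: "interchange_quantale (function_order X Q)
      (convolution X Q R (\<bullet>)) (convolution X Q S (\<diamondop>)) (id_on_units X Q E un)"
    and E: "E \<noteq> {}" "E \<subseteq> X"
  shows "interchange_quantale Q (\<bullet>) (\<diamondop>) un"
proof (cases "un = \<bottom>")
  case True
  then show ?thesis
    by (rule interchange_quantale_if_trivial)
next
  case False
  interpret F: interchange_quantale "function_order X Q"
    "convolution X Q R (\<bullet>)" "convolution X Q S (\<diamondop>)" "id_on_units X Q E un"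
    by fact
  \<comment> \<open>The second implication supplies the relational units that
    \<open>convolution_at_unit\<close> requires.\<close>
  interpret X: relational_interchange_monoid X R S E
    using F False E(2) by (rule relational_interchange_monoid_if_function_order)
  obtain e where e: "e \<in> E" "e \<in> X"
    using E by blast
  let ?d = "id_on_units X Q {e}"
  have d: "?d a \<in> carrier (function_order X Q)" if "a \<in> carrier Q" for a
    using bul.id_on_units_closed[OF that] by (simp add: function_order_def)
  \<comment> \<open>Evaluation at \<open>e\<close> undoes the embedding \<open>?d\<close> of
    \<open>Q\<close> into the function space, so laws between images of \<open>?d\<close> descend to
    \<open>Q\<close>.\<close>
  have at_e: "?d a e = a" for a
    using e by (simp add: id_on_units_def)
  note conv = bul.convolution_at_unit[OF X.R_units e(1)] dia.convolution_at_unit[OF X.S_units e(1)]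
  show ?thesis
  proof
    fix a b c
    assume abc: "a \<in> carrier Q" "b \<in> carrier Q" "c \<in> carrier Q"
    have "?d (a \<bullet> b \<bullet> c) = ?d (a \<bullet> (b \<bullet> c))"
      using F.bul_assoc[OF d d d, OF abc] abc by (simp add: conv)
    from fun_cong[OF this, of e] show "a \<bullet> b \<bullet> c = a \<bullet> (b \<bullet> c)"
      by (simp only: at_e)
    have "?d (a \<diamondop> b \<diamondop> c) = ?d (a \<diamondop> (b \<diamondop> c))"
      using F.dia_assoc[OF d d d, OF abc] abc by (simp add: conv)
    from fun_cong[OF this, of e] show "a \<diamondop> b \<diamondop> c = a \<diamondop> (b \<diamondop> c)"
      by (simp only: at_e)
  next
    fix a b c d'
    assume abcd: "a \<in> carrier Q" "b \<in> carrier Q" "c \<in> carrier Q" "d' \<in> carrier Q"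
    have "?d ((a \<diamondop> b) \<bullet> (c \<diamondop> d')) \<sqsubseteq>\<^bsub>function_order X Q\<^esub> ?d ((a \<bullet> c) \<diamondop> (b \<bullet> d'))"
      using F.interchange[OF d d d d, OF abcd] abcd by (simp add: conv)
    then have "?d ((a \<diamondop> b) \<bullet> (c \<diamondop> d')) e \<sqsubseteq> ?d ((a \<bullet> c) \<diamondop> (b \<bullet> d')) e"
      using e(2) by (simp add: function_order_def)
    then show "(a \<diamondop> b) \<bullet> (c \<diamondop> d') \<sqsubseteq> (a \<bullet> c) \<diamondop> (b \<bullet> d')"
      by (simp add: at_e)
  qed
qed

end

theorem theorem5p6:
  fixes X :: "'x set"
    and R S :: "'x \<Rightarrow> 'x \<Rightarrow> 'x \<Rightarrow> bool"
    and E :: "'x set"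
    and Q :: "'q gorder"
    and bul dia :: "'q \<Rightarrow> 'q \<Rightarrow> 'q"
    and un :: 'q
  assumes "E \<subseteq> X"
    and "unital_double_prequantale Q bul dia un"
  shows
    "(relational_interchange_monoid X R S E \<and> interchange_quantale Q bul dia un \<longrightarrow>
        interchange_quantale (function_order X Q)
          (convolution X Q R bul) (convolution X Q S dia) (id_on_units X Q E un)) \<and>
     (interchange_quantale (function_order X Q)
          (convolution X Q R bul) (convolution X Q S dia) (id_on_units X Q E un) \<and>
        un \<noteq> \<bottom>\<^bsub>Q\<^esub> \<longrightarrow>
        relational_interchange_monoid X R S E) \<and>
     (interchange_quantale (function_order X Q)
          (convolution X Q R bul) (convolution X Q S dia) (id_on_units X Q E un) \<and>
        E \<noteq> {} \<longrightarrow>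
        interchange_quantale Q bul dia un)"
proof -
  interpret unital_double_prequantale Q bul dia un
    by fact
  show ?thesis
    using interchange_quantale_function_order[of X R S E]
      relational_interchange_monoid_if_function_order[of X R S E]
      interchange_quantale_if_function_order[of X R S E] \<open>E \<subseteq> X\<close>
    by simp
qed

end
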